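(* Let $n$ be a positive integer. The number of different diagonal vectors in standard shifted Young tableaux of the triangular shape $(n,n-1,\dots,1)$ is exactly the number of integer lattice points in the associahedron $\mathrm{Ass}_{n-1}$. More precisely, for nonnegative integers $a_1,\dots,a_{n-1}$, the number $N(a_1,\dots,a_{n-1})$ is nonzero if and only if $(a_1,\dots,a_{n-1})$ is an integer lattice point of $\mathrm{Ass}_{n-1}$.
   Context: A standard shifted Young tableau of the triangular shape $(n,n-1,\dots,1)$ is a bijection $T:\{(i,j)\mid1\le i\le j\le n\}\to\{1,\dots,\binom{n+1}{2}\}$ that is increasing in rows and columns, i.e. $T(i,j)<T(i+1,j)$ and $T(i,j)<T(i,j+1)$ whenever the entries are defined. Its diagonal vector is $\mathrm{diag}(T)=(T(1,1),T(2,2),\dots,T(n,n))$. For a nonnegative integer vector $(a_1,\dots,a_{n-1})$, $N(a_1,\dots,a_{n-1})$ is the number of such tableaux $T$ with $\mathrm{diag}(T)=(d_1,\dots,d_n)$, $d_1=1$, and $a_i=d_{i+1}-d_i-1$ for $i=1,\dots,n-1$, i.e. with $\mathrm{diag}(T)=(1,\,a_1+2,\,a_1+a_2+3,\dots,a_1+\cdots+a_{n-1}+n)$. The associahedron (in the Loday realization) is the Minkowski sum $\mathrm{Ass}_{n-1}=\sum_{1\le i<j\le n}\Delta_{[i,j-1]}\subset\mathbb{R}^{n-1}$, where $[i,j-1]=\{i,i+1,\dots,j-1\}$ and $\Delta_I=\mathrm{ConvexHull}(e_k\mid k\in I)$ with $e_1,\dots,e_{n-1}$ the coordinate vectors of $\mathbb{R}^{n-1}$;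 equivalently it is the Newton polytope of $\prod_{1\le i<j\le n}(t_i+t_{i+1}+\cdots+t_{j-1})$. (For $n=1$, $\mathrm{Ass}_0$ is the single point of $\mathbb{R}^0$.) *)

theory Defs
  imports
    "HOL-Analysis.Analysis"
    "HOL-Analysis.Finite_Function_Topology"
    "HOL-Library.Set_Algebras"
    "HOL-Library.FuncSet"
begin

definition shifted_staircase :: "nat \<Rightarrow> (nat \<times> nat) set" where
  "shifted_staircase n = {(i, j). 1 \<le> i \<and> i \<le> j \<and> j \<le> n}"

text \<open>Tableaux are taken extensional (i.e. \<open>undefined\<close> outside the shape), so that distinct elements
  of the following set are distinct as functions on the shape, and the set is finite.\<close>

definition shifted_tableaux :: "nat \<Rightarrow> (nat \<times> nat \<Rightarrow> nat) set" where
  "shifted_tableaux n =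
    {T \<in> extensional (shifted_staircase n).
       bij_betw T (shifted_staircase n) {1..Suc n choose 2} \<and>
       (\<forall>i j. (i, j) \<in> shifted_staircase n \<and> (Suc i, j) \<in> shifted_staircase n
          \<longrightarrow> T (i, j) < T (Suc i, j)) \<and>
       (\<forall>i j. (i, j) \<in> shifted_staircase n \<and> (i, Suc j) \<in> shifted_staircase n
          \<longrightarrow> T (i, j) < T (i, Suc j))}"

definition diag_vector :: "nat \<Rightarrow> (nat \<times> nat \<Rightarrow> nat) \<Rightarrow> nat list" where
  "diag_vector n T = map (\<lambda>i. T (i, i)) [1..<Suc n]"

text \<open>A vector \<open>(a\<^sub>1, \<dots>, a\<^sub>n\<^sub>-\<^sub>1)\<close> of nonnegative integers is given by a function of which only the values
  at \<open>1, \<dots>, n - 1\<close> matter. The list on the right-hand side is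
  \<open>(1, a\<^sub>1 + 2, a\<^sub>1 + a\<^sub>2 + 3, \<dots>, a\<^sub>1 + \<dots> + a\<^sub>n\<^sub>-\<^sub>1 + n)\<close>.\<close>

definition num_tableaux :: "nat \<Rightarrow> (nat \<Rightarrow> nat) \<Rightarrow> nat" where
  "num_tableaux n a =
    card {T \<in> shifted_tableaux n. diag_vector n T = map (\<lambda>i. (\<Sum>k=1..<i. a k) + i) [1..<Suc n]}"

text \<open>\<open>\<real>\<^sup>m\<close> is identified with the subspace of those vectors of type \<^typ>\<open>nat \<Rightarrow>\<^sub>0 real\<close> that are supported
  on \<open>{1..m}\<close>. All the polytopes below, with vertices among sums of \<open>e\<^sub>1, \<dots>, e\<^sub>m\<close>, lie in it.\<close>

definition coord_vector :: "nat \<Rightarrow> (nat \<Rightarrow>\<^sub>0 real)" where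
  "coord_vector k = Poly_Mapping.single k 1"

definition coord_simplex :: "nat set \<Rightarrow> (nat \<Rightarrow>\<^sub>0 real) set" where
  "coord_simplex I = convex hull (coord_vector ` I)"

text \<open>The parameter \<open>m\<close> is the dimension, so \<open>Ass\<^sub>m\<close> is a sum over \<open>1 \<le> i < j \<le> m + 1\<close>. The sum of sets is
  the Minkowski sum, with the empty sum being \<open>{0}\<close>; \<open>{i..<j}\<close> is the interval \<open>[i, j - 1]\<close>.\<close>

definition associahedron :: "nat \<Rightarrow> (nat \<Rightarrow>\<^sub>0 real) set" where
  "associahedron m =
    (\<Sum>(i, j) \<in> {(i, j). 1 \<le> i \<and> i < j \<and> j \<le> Suc m}. coord_simplex {i..<j})"

definition lattice_points :: "(nat \<Rightarrow>\<^sub>0 real) set \<Rightarrow> (nat \<Rightarrow>\<^sub>0 real) set" where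
  "lattice_points P = {x \<in> P. \<forall>k. Poly_Mapping.lookup x k \<in> \<int>}"

definition point_of :: "nat \<Rightarrow> (nat \<Rightarrow> nat) \<Rightarrow> (nat \<Rightarrow>\<^sub>0 real)" where
  "point_of m a = (\<Sum>k=1..m. real (a k) *\<^sub>R coord_vector k)"

end

theory Submission
  imports Defs
begin

text \<open>An entry \<open>T (i, j)\<close> with \<open>i < j\<close> lies strictly between two consecutive diagonal entries \<open>T (k, k)\<close>
  and \<open>T (k + 1, k + 1)\<close> with \<open>i \<le> k < j\<close>. So a tableau chooses for every interval \<open>[i, j - 1]\<close> one of
  its elements \<open>k = f (i, j)\<close>, and \<open>a\<^sub>k\<close> counts how often \<open>k\<close> is chosen; thus \<open>a\<close> is the sum of the
  vertices \<open>e\<^bsub>f (i, j)\<^esub>\<close> of the summands of the associahedron. Conversely, every lattice point of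
  the Minkowski sum is such a sum of vertices, by Hall's theorem. Exchanging values makes a choice
  \<open>f\<close> with given multiplicities monotone in \<open>i\<close> and \<open>j\<close>, and then a tableau is obtained by filling
  in, for increasing \<open>k\<close>, the diagonal cell \<open>(k, k)\<close> followed by the cells with \<open>f (i, j) = k\<close>.\<close>

section \<open>Hall's theorem with prescribed multiplicities\<close>

lemma card_Collect_insert:
  assumes "finite C" "c \<notin> C"
  shows "card {x \<in> insert c C. P x} = card {x \<in> C. P x} + of_bool (P c)"
proof (cases "P c")
  case True
  then have "{x \<in> insert c C. P x} = insert c {x \<in> C. P x}" by auto
  with True assms show ?thesis by simp
next
  case False
  then have "{x \<in> insert c C. P x} = {x \<in> C. P x}" by auto
  with False show ?thesis by simp
qed

text \<open>The cells with \<open>A c\<close> inside \<open>S\<close> and those with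
  \<open>A c\<close> inside \<open>T\<close> overlap exactly in those inside
  \<open>S \<inter> T\<close>, and all of them lie inside \<open>S \<union> T\<close>. This
  supermodularity makes the tight sets of the next proof closed under union.\<close>

lemma card_subsets_supermodular:
  assumes "finite C"
  shows "card {c \<in> C. A c \<subseteq> S} + card {c \<in> C. A c \<subseteq> T}
    \<le> card {c \<in> C. A c \<subseteq> S \<union> T} + card {c \<in> C. A c \<subseteq> S \<inter> T}"
proof -
  let ?g = "\<lambda>S. {c \<in> C. A c \<subseteq> S}"
  have "card (?g S) + card (?g T) = card (?g S \<union> ?g T) + card (?g S \<inter> ?g T)"
    using assms by (intro card_Un_Int) auto
  moreover have "card (?g S \<union> ?g T) \<le> card (?g (S \<union> T))"
    using assms by (intro card_mono) auto
  moreover have "?g S \<inter> ?g T = ?g (S \<inter> T)" by auto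
  ultimately show ?thesis by simp
qed

text \<open>Since \<open>sum a U = card C\<close>, the last condition says by complementation that
  at least \<open>sum a (U - S)\<close> cells have a choice outside \<open>S\<close>. This is Hall's
  condition for matching \<open>a k\<close> copies of each \<open>k\<close> to the cells.\<close>

theorem assignment_with_prescribed_multiplicities:
  fixes a :: "'b \<Rightarrow> nat" and A :: "'c \<Rightarrow> 'b set"
  assumes "finite U" "finite C" "sum a U = card C"
    and "\<And>c. c \<in> C \<Longrightarrow> A c \<subseteq> U"
    and "\<And>S. S \<subseteq> U \<Longrightarrow> card {c \<in> C. A c \<subseteq> S} \<le> sum a S"
  shows "\<exists>f. (\<forall>c\<in>C. f c \<in> A c) \<and> (\<forall>k\<in>U. card {c \<in> C. f c = k} = a k)"
  using assms(2-5)
proof (induction C arbitrary: a rule: finite_induct)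
  case empty
  with \<open>finite U\<close> show ?case by simp
next
  case (insert c C)
  let ?g = "\<lambda>S. card {x \<in> C. A x \<subseteq> S}"
  have g: "?g S + of_bool (A c \<subseteq> S) \<le> sum a S" if "S \<subseteq> U" for S
    using insert.prems(3)[OF that] card_Collect_insert[OF insert.hyps, of "\<lambda>x. A x \<subseteq> S"] by simp
  \<comment> \<open>\<open>M\<close> is the largest set that is tight for \<open>C\<close> alone, so a \<open>k\<close> outside \<open>M\<close> is in no tight set and can
    be given to \<open>c\<close>.\<close>
  define M where "M = \<Union> {S. S \<subseteq> U \<and> sum a S = ?g S}"
  have fin: "finite S" if "S \<subseteq> U" for S using that \<open>finite U\<close> finite_subset by blast
  have tight_Un: "sum a (S \<union> T) = ?g (S \<union> T)"
    if S: "S \<subseteq> U" "sum a S = ?g S" and T: "T \<subseteq> U" "sum a T = ?g T" for S T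
  proof -
    have "sum a (S \<union> T) + sum a (S \<inter> T) = sum a S + sum a T"
      using fin S T by (intro sum.union_inter) auto
    moreover have "?g (S \<union> T) \<le> sum a (S \<union> T)" "?g (S \<inter> T) \<le> sum a (S \<inter> T)"
      using g[of "S \<union> T"] g[of "S \<inter> T"] S T by (auto simp: le_infI1)
    ultimately show ?thesis
      using card_subsets_supermodular[OF insert.hyps(1), of A S T] S(2) T(2) by linarith
  qed
  have tight_Union: "\<Union> F \<subseteq> U \<and> sum a (\<Union> F) = ?g (\<Union> F)"
    if "finite F" "F \<subseteq> {S. S \<subseteq> U \<and> sum a S = ?g S}" for F
    using that
  proof (induction F rule: finite_induct)
    case empty
    \<comment> \<open>The empty union is tight: Hall's condition at \<open>{}\<close> rules out
      empty choice sets.\<close>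
    have "A x \<noteq> {}" if "x \<in> C" for x
      using insert.prems(3)[of "{}"] that insert.hyps(1) by auto
    then have "{x \<in> C. A x \<subseteq> {}} = {}" by auto
    then show ?case by (metis Sup_empty card.empty empty_subsetI sum.empty)
  next
    case (insert S F)
    then show ?case using tight_Un[of S "\<Union> F"] by auto
  qed
  have "finite {S. S \<subseteq> U \<and> sum a S = ?g S}" using \<open>finite U\<close> by simp
  then have M: "M \<subseteq> U" "sum a M = ?g M" unfolding M_def using tight_Union by blast+
  \<comment> \<open>If \<open>A c\<close> were inside the tight set \<open>M\<close>, the cells
    confined to \<open>M\<close> would outnumber \<open>sum a M\<close>.\<close>
  with g[of M] have "\<not> A c \<subseteq> M" by auto
  then obtain k where k: "k \<in> A c" "k \<notin> M" by blast
  with insert.prems(2) have "k \<in> U" by blast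
  have slack: "?g S < sum a S" if "S \<subseteq> U" "k \<in> S" for S
  proof -
    have "sum a S \<noteq> ?g S" using that k(2) unfolding M_def by blast
    with g[OF that(1)] show ?thesis by simp
  qed
  have "a k > 0" using slack[of "{k}"] \<open>k \<in> U\<close> by simp
  \<comment> \<open>One copy of \<open>k\<close> is used up by \<open>c\<close>; the subtraction is
    exact because \<open>a k > 0\<close>.\<close>
  define a' where "a' = a(k := a k - 1)"
  have sum_a': "sum a S = sum a' S + of_bool (k \<in> S)" if "S \<subseteq> U" for S
  proof (cases "k \<in> S")
    case True
    then have "sum b S = b k + sum b (S - {k})" for b :: "'b \<Rightarrow> nat"
      using fin[OF that] by (simp add: sum.remove)
    moreover have "sum a' (S - {k}) = sum a (S - {k})" by (intro sum.cong) (auto simp: a'_def)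
    ultimately show ?thesis using True \<open>a k > 0\<close> by (simp add: a'_def)
  next
    case False
    then show ?thesis by (auto simp: a'_def intro!: sum.cong)
  qed
  have "\<exists>f. (\<forall>x\<in>C. f x \<in> A x) \<and> (\<forall>l\<in>U. card {x \<in> C. f x = l} = a' l)"
  proof (rule insert.IH)
    show "sum a' U = card C"
      using sum_a'[of U] \<open>k \<in> U\<close> insert.prems(1) insert.hyps by simp
    show "A x \<subseteq> U" if "x \<in> C" for x using insert.prems(2) that by blast
    show "?g S \<le> sum a' S" if "S \<subseteq> U" for S
      using sum_a'[OF that] slack[OF that] g[OF that] by (cases "k \<in> S") auto
  qed
  then obtain f where f: "\<forall>x\<in>C. f x \<in> A x" "\<forall>l\<in>U. card {x \<in> C. f x = l} = a' l" by blast
  let ?f = "f(c := k)"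
  have "card {x \<in> insert c C. ?f x = l} = a l" if "l \<in> U" for l
  proof -
    have "{x \<in> C. ?f x = l} = {x \<in> C. f x = l}" using insert.hyps(2) by auto
    then show ?thesis
      using card_Collect_insert[OF insert.hyps, of "\<lambda>x. ?f x = l"] f(2) that \<open>a k > 0\<close>
      by (auto simp: a'_def)
  qed
  then show ?case using f(1) k(1) insert.hyps(2) by (intro exI[of _ ?f]) auto
qed

section \<open>Slot assignments and lattice points of the associahedron\<close>

text \<open>The same pairs index the cells off the diagonal and the summands of the
  associahedron.\<close>

definition off_diagonal :: "nat \<Rightarrow> (nat \<times> nat) set" where
  "off_diagonal n = {(i, j). 1 \<le> i \<and> i < j \<and> j \<le> n}"

definition slot_assignment :: "nat \<Rightarrow> (nat \<times> nat \<Rightarrow> nat) \<Rightarrow> bool" where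
  "slot_assignment n f \<longleftrightarrow> (\<forall>(i, j) \<in> off_diagonal n. f (i, j) \<in> {i..<j})"

text \<open>The middle term of the equivalence: diagonal vectors and lattice points are each
  compared with it.\<close>

definition realizable :: "nat \<Rightarrow> (nat \<Rightarrow> nat) \<Rightarrow> bool" where
  "realizable n a \<longleftrightarrow>
    (\<exists>f. slot_assignment n f \<and> (\<forall>k\<in>{1..<n}. card {c \<in> off_diagonal n. f c = k} = a k))"

lemma finite_off_diagonal [simp]: "finite (off_diagonal n)"
  by (rule finite_subset[of _ "{..n} \<times> {..n}"]) (auto simp: off_diagonal_def)

lemma slot_assignment_range:
  assumes "slot_assignment n f" "c \<in> off_diagonal n"
  shows "f c \<in> {1..<n}"
  using assms by (fastforce simp: slot_assignment_def off_diagonal_def)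

lemma lookup_scaleR: "Poly_Mapping.lookup (r *\<^sub>R x) k = r *\<^sub>R Poly_Mapping.lookup x k"
  for x :: "'a \<Rightarrow>\<^sub>0 'b :: real_vector"
proof -
  have "finite {i. r *\<^sub>R Poly_Mapping.lookup x i \<noteq> 0}"
    by (rule finite_subset[OF _ finite_keys[of x]]) (auto simp: in_keys_iff)
  then show ?thesis by (simp add: scaleR_poly_mapping_def)
qed

lemma lookup_coord_vector: "Poly_Mapping.lookup (coord_vector k) l = of_bool (k = l)"
  by (simp add: coord_vector_def lookup_single when_def)

lemma lookup_point_of: "Poly_Mapping.lookup (point_of m a) k = (if k \<in> {1..m} then real (a k) else 0)"
  by (simp add: point_of_def lookup_sum lookup_scaleR lookup_coord_vector of_bool_def if_distrib cong: if_cong)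

lemma point_of_eq_iff: "point_of m a = point_of m b \<longleftrightarrow> (\<forall>k\<in>{1..m}. a k = b k)"
  by (auto simp: poly_mapping_eq_iff fun_eq_iff lookup_point_of)

text \<open>The three conditions define a convex set containing the vertices, hence containing their
  hull.\<close>

lemma coord_simplexD:
  assumes "x \<in> coord_simplex I" "finite I"
  shows "Poly_Mapping.lookup x k \<ge> 0" "k \<notin> I \<Longrightarrow> Poly_Mapping.lookup x k = 0"
    "(\<Sum>k\<in>I. Poly_Mapping.lookup x k) = 1"
proof -
  let ?P = "{x :: nat \<Rightarrow>\<^sub>0 real. (\<forall>k. Poly_Mapping.lookup x k \<ge> 0) \<and>
    (\<forall>k. k \<notin> I \<longrightarrow> Poly_Mapping.lookup x k = 0) \<and> (\<Sum>k\<in>I. Poly_Mapping.lookup x k) = 1}"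
  have "convex ?P"
    unfolding convex_def
    by (auto simp: lookup_add lookup_scaleR sum.distrib simp flip: sum_distrib_left)
  moreover have "coord_vector ` I \<subseteq> ?P"
    using \<open>finite I\<close> by (auto simp: lookup_coord_vector of_bool_def)
  ultimately have "coord_simplex I \<subseteq> ?P"
    unfolding coord_simplex_def by (rule hull_minimal[rotated])
  with assms(1) show "Poly_Mapping.lookup x k \<ge> 0" "k \<notin> I \<Longrightarrow> Poly_Mapping.lookup x k = 0"
    "(\<Sum>k\<in>I. Poly_Mapping.lookup x k) = 1" by auto
qed

lemma in_associahedron_iff:
  assumes "n \<ge> 1"
  shows "x \<in> associahedron (n - 1) \<longleftrightarrow>
    (\<exists>v. x = sum v (off_diagonal n) \<and> (\<forall>(i, j) \<in> off_diagonal n. v (i, j) \<in> coord_simplex {i..<j}))"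
proof -
  have "associahedron (n - 1) = (\<Sum>(i, j) \<in> off_diagonal n. coord_simplex {i..<j})"
    using assms by (simp add: associahedron_def off_diagonal_def)
  then show ?thesis by (auto simp: set_sum_alt)
qed

text \<open>Taking the vertex \<open>coord_vector (f c)\<close> in each summand gives a point whose
  \<open>k\<close>-th coordinate counts the cells with \<open>f c = k\<close>.\<close>

lemma realizable_imp_lattice_point:
  assumes "n \<ge> 1" "realizable n a"
  shows "point_of (n - 1) a \<in> lattice_points (associahedron (n - 1))"
proof -
  obtain f where f: "slot_assignment n f" "\<forall>k\<in>{1..<n}. card {c \<in> off_diagonal n. f c = k} = a k"
    using assms(2) by (auto simp: realizable_def)
  have "point_of (n - 1) a = (\<Sum>c\<in>off_diagonal n. coord_vector (f c))"
  proof (rule poly_mapping_eqI)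
    fix k
    have *: "Poly_Mapping.lookup (\<Sum>c\<in>off_diagonal n. coord_vector (f c)) k
      = real (card {c \<in> off_diagonal n. f c = k})"
      by (simp add: lookup_sum lookup_coord_vector of_bool_def sum.If_cases Int_def)
    show "Poly_Mapping.lookup (point_of (n - 1) a) k
      = Poly_Mapping.lookup (\<Sum>c\<in>off_diagonal n. coord_vector (f c)) k"
    proof (cases "k \<in> {1..<n}")
      case True
      with f(2) show ?thesis unfolding * by (auto simp: lookup_point_of)
    next
      case False
      then have "{c \<in> off_diagonal n. f c = k} = {}" using slot_assignment_range[OF f(1)] by blast
      with False show ?thesis unfolding * by (auto simp: lookup_point_of)
    qed
  qed
  moreover have "\<forall>(i, j) \<in> off_diagonal n. coord_vector (f (i, j)) \<in> coord_simplex {i..<j}"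
    using f(1) by (auto simp: slot_assignment_def coord_simplex_def intro!: hull_inc)
  ultimately have "point_of (n - 1) a \<in> associahedron (n - 1)"
    unfolding in_associahedron_iff[OF assms(1)] by blast
  then show ?thesis by (auto simp: lattice_points_def lookup_point_of)
qed

text \<open>Write \<open>x\<close> as a sum of points \<open>v c\<close> of the simplices. If the
  interval of \<open>c\<close> lies in \<open>S\<close>, then \<open>v c\<close> contributes its
  whole coordinate sum 1 to the coordinates in \<open>S\<close>; otherwise it contributes at least
  0. Summing over \<open>c\<close> gives Hall's condition for the coordinates of
  \<open>x\<close>.\<close>

lemma lattice_point_imp_realizable:
  assumes "n \<ge> 1" "x \<in> lattice_points (associahedron (n - 1))"
  shows "\<exists>a. realizable n a \<and> x = point_of (n - 1) a"
proof -
  let ?C = "off_diagonal n" and ?A = "\<lambda>(i, j). {i..<j} :: nat set"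
  let ?l = "Poly_Mapping.lookup"
  obtain v where x: "x = sum v ?C" and "\<forall>(i, j) \<in> ?C. v (i, j) \<in> coord_simplex {i..<j}"
    using assms(2) unfolding lattice_points_def in_associahedron_iff[OF assms(1)] by blast
  then have v: "v c \<in> coord_simplex (?A c)" "finite (?A c)" if "c \<in> ?C" for c using that by auto
  note vD = coord_simplexD[OF v]
  have AU: "?A c \<subseteq> {1..<n}" if "c \<in> ?C" for c using that by (auto simp: off_diagonal_def)
  have lx: "?l x k = (\<Sum>c\<in>?C. ?l (v c) k)" for k by (simp add: x lookup_sum)
  have nonneg: "?l x k \<ge> 0" for k unfolding lx by (intro sum_nonneg vD(1))
  have "\<forall>k. \<exists>b :: nat. ?l x k = real b"
  proof
    fix k
    have "?l x k \<in> \<int>" using assms(2) by (simp add: lattice_points_def)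
    then obtain z where "?l x k = of_int z" by (elim Ints_cases)
    then show "\<exists>b :: nat. ?l x k = real b" using nonneg[of k] by (intro exI[of _ "nat z"]) auto
  qed
  then obtain a :: "nat \<Rightarrow> nat" where a: "\<And>k. ?l x k = real (a k)" by metis
  have sum_a: "real (sum a S) = (\<Sum>c\<in>?C. \<Sum>k\<in>S. ?l (v c) k)" for S
    unfolding of_nat_sum a[symmetric] lx by (rule sum.swap)
  have ge: "of_bool (?A c \<subseteq> S) \<le> (\<Sum>k\<in>S. ?l (v c) k)" if "c \<in> ?C" "S \<subseteq> {1..<n}" for c S
  proof (cases "?A c \<subseteq> S")
    case True
    have "finite S" using that(2) finite_subset by blast
    then have "(\<Sum>k\<in>?A c. ?l (v c) k) \<le> (\<Sum>k\<in>S. ?l (v c) k)"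
      using True that vD(1) by (intro sum_mono2) auto
    then show ?thesis using True vD(3)[OF that(1) that(1)] by simp
  next
    case False
    then show ?thesis using vD(1)[OF that(1) that(1)] by (auto intro: sum_nonneg)
  qed
  have "\<exists>f. (\<forall>c\<in>?C. f c \<in> ?A c) \<and> (\<forall>k\<in>{1..<n}. card {c \<in> ?C. f c = k} = a k)"
  proof (rule assignment_with_prescribed_multiplicities)
    have "(\<Sum>k\<in>{1..<n}. ?l (v c) k) = 1" if "c \<in> ?C" for c
      using sum.mono_neutral_left[of "{1..<n}" "?A c" "?l (v c)"] AU[OF that]
        vD(2,3)[OF that that] by auto
    then have "real (sum a {1..<n}) = real (card ?C)" unfolding sum_a by simp
    then show "sum a {1..<n} = card ?C" by linarith
    show "card {c \<in> ?C. ?A c \<subseteq> S} \<le> sum a S" if "S \<subseteq> {1..<n}" for S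
    proof -
      have "real (card {c \<in> ?C. ?A c \<subseteq> S}) = (\<Sum>c\<in>?C. of_bool (?A c \<subseteq> S))"
        by (simp add: of_bool_def sum.If_cases Int_def)
      also have "\<dots> \<le> real (sum a S)" unfolding sum_a by (intro sum_mono ge that)
      finally show ?thesis by (simp only: of_nat_le_iff)
    qed
  qed (use AU in auto)
  then have "realizable n a" unfolding realizable_def slot_assignment_def by fastforce
  moreover have "x = point_of (n - 1) a"
  proof (rule poly_mapping_eqI)
    fix k
    have "?l x k = 0" if "k \<notin> {1..<n}"
      unfolding lx using AU that vD(2) by (intro sum.neutral) blast
    then show "?l x k = ?l (point_of (n - 1) a) k"
      using a[of k] by (auto simp: lookup_point_of)
  qed
  ultimately show ?thesis by blast
qed


section \<open>From tableaux to slot assignments\<close>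

lemma off_diagonal_subset: "off_diagonal n \<subseteq> shifted_staircase n"
  by (auto simp: off_diagonal_def shifted_staircase_def)

lemma shifted_staircase_cases:
  assumes "c \<in> shifted_staircase n"
  obtains k where "c = (k, k)" "k \<in> {1..n}" | "c \<in> off_diagonal n"
  using assms by (cases c) (force simp: shifted_staircase_def off_diagonal_def)

lemma finite_shifted_staircase [simp]: "finite (shifted_staircase n)"
  by (rule finite_subset[of _ "{..n} \<times> {..n}"]) (auto simp: shifted_staircase_def)

lemma card_shifted_staircase: "card (shifted_staircase n) = Suc n choose 2"
proof (induction n)
  case 0
  have "shifted_staircase 0 = {}" by (auto simp: shifted_staircase_def)
  then show ?case by simp
next
  case (Suc n)
  have "shifted_staircase (Suc n) = shifted_staircase n \<union> {1..Suc n} \<times> {Suc n}"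
    by (auto simp: shifted_staircase_def)
  moreover have "shifted_staircase n \<inter> {1..Suc n} \<times> {Suc n} = {}"
    by (auto simp: shifted_staircase_def)
  ultimately show ?case
    using Suc by (simp add: card_Un_disjoint numeral_2_eq_2)
qed

definition diag_positions :: "nat \<Rightarrow> (nat \<Rightarrow> nat) \<Rightarrow> nat list" where
  "diag_positions n a = map (\<lambda>i. (\<Sum>k=1..<i. a k) + i) [1..<Suc n]"

text \<open>Consecutive entries differ by \<open>a k + 1\<close>, so the list determines
  \<open>a\<close> on \<open>{1..<n}\<close>.\<close>

lemma diag_positions_eq_iff:
  "diag_positions n a = diag_positions n b \<longleftrightarrow> (\<forall>k\<in>{1..<n}. a k = b k)"
proof
  assume "diag_positions n a = diag_positions n b"
  then have eq: "(\<Sum>k=1..<i. a k) = (\<Sum>k=1..<i. b k)" if "i \<in> {1..n}" for i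
    using that by (auto simp: diag_positions_def simp del: upt_Suc)
  show "\<forall>k\<in>{1..<n}. a k = b k"
  proof
    fix k assume "k \<in> {1..<n}"
    then show "a k = b k" using eq[of k] eq[of "Suc k"] by simp
  qed
next
  assume "\<forall>k\<in>{1..<n}. a k = b k"
  then show "diag_positions n a = diag_positions n b"
    by (auto simp: diag_positions_def simp del: upt_Suc intro!: sum.cong)
qed

lemma diag_vector_eq_diag_positions_iff:
  "diag_vector n T = diag_positions n a \<longleftrightarrow> (\<forall>i\<in>{1..n}. T (i, i) = (\<Sum>k=1..<i. a k) + i)"
  by (auto simp: diag_vector_def diag_positions_def simp del: upt_Suc)

text \<open>These are the cells filled in up to and including \<open>(i, i)\<close>. The count
  serves both directions: reading slots off a tableau and building a tableau from slots.\<close>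

lemma card_diagonal_and_lower_slots:
  assumes "slot_assignment n f" "1 \<le> i"
  shows "card ((\<lambda>k. (k, k)) ` {1..i} \<union> {c \<in> off_diagonal n. f c < i})
    = (\<Sum>k=1..<i. card {c \<in> off_diagonal n. f c = k}) + i"
proof -
  have eq: "{c \<in> off_diagonal n. f c < i} = (\<Union>k\<in>{1..<i}. {c \<in> off_diagonal n. f c = k})"
    using slot_assignment_range[OF assms(1)] by fastforce
  have "card {c \<in> off_diagonal n. f c < i} = (\<Sum>k=1..<i. card {c \<in> off_diagonal n. f c = k})"
    unfolding eq by (rule card_UN_disjoint) auto
  moreover have "(\<lambda>k. (k, k)) ` {1..i} \<inter> {c \<in> off_diagonal n. f c < i} = {}"
    by (auto simp: off_diagonal_def)
  moreover have "card ((\<lambda>k. (k, k)) ` {1..i}) = i"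
    by (simp add: card_image inj_on_def)
  ultimately show ?thesis by (simp add: card_Un_disjoint)
qed

text \<open>Since \<open>T\<close> is a bijection onto an initial segment, \<open>T (i, i)\<close>
  is the number of cells with value at most \<open>T (i, i)\<close>: the first \<open>i\<close>
  diagonal cells and the off-diagonal cells with slot below \<open>i\<close>. So the slot
  multiplicities are the gaps of the diagonal.\<close>

lemma shifted_tableaux_imp_realizable:
  assumes "T \<in> shifted_tableaux n"
  shows "\<exists>a. realizable n a \<and> diag_vector n T = diag_positions n a"
proof -
  let ?S = "shifted_staircase n" and ?C = "off_diagonal n"
  have bij: "bij_betw T ?S {1..Suc n choose 2}"
    and col: "\<And>i j. (i, j) \<in> ?S \<Longrightarrow> (Suc i, j) \<in> ?S \<Longrightarrow> T (i, j) < T (Suc i, j)"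
    and row: "\<And>i j. (i, j) \<in> ?S \<Longrightarrow> (i, Suc j) \<in> ?S \<Longrightarrow> T (i, j) < T (i, Suc j)"
    using assms by (auto simp: shifted_tableaux_def)
  \<comment> \<open>Going along row \<open>i\<close> to \<open>(i, j)\<close> and then down column
    \<open>j\<close> traps \<open>T (i, j)\<close> between \<open>T (i, i)\<close> and
    \<open>T (j, j)\<close>.\<close>
  have right: "T (i, i) < T (i, j)" if "i < j" "1 \<le> i" "j \<le> n" for i j
  proof -
    from that(1) have "Suc i \<le> j" by simp
    then show ?thesis using that(2,3)
    proof (induction j rule: dec_induct)
      case base
      then show ?case by (intro row) (auto simp: shifted_staircase_def)
    next
      case (step j)
      then have "T (i, j) < T (i, Suc j)" by (intro row) (auto simp: shifted_staircase_def)
      with step show ?case by simp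
    qed
  qed
  have down: "T (i, j) < T (j, j)" if "i < j" "1 \<le> i" "j \<le> n" for i j
    using that
  proof (induction i rule: strict_inc_induct)
    case (base i)
    then show ?case using col[of i "Suc i"] by (auto simp: shifted_staircase_def)
  next
    case (step i)
    then have "T (i, j) < T (Suc i, j)" by (intro col) (auto simp: shifted_staircase_def)
    with step show ?case by simp
  qed
  have diag: "T (k, k) \<le> T (i, i) \<longleftrightarrow> k \<le> i" if "k \<in> {1..n}" "i \<in> {1..n}" for k i
    using that right[of k i] down[of k i] right[of i k] down[of i k]
    by (cases k i rule: linorder_cases) auto
  \<comment> \<open>As the diagonal increases, this is the index of the last diagonal entry below
    \<open>T c\<close>, or 0 if there is none.\<close>
  define f where "f c = card {k \<in> {1..n}. T (k, k) < T c}" for c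
  have f: "f c < i \<longleftrightarrow> T c \<le> T (i, i)" if "i \<in> {1..n}" for c i
  proof (cases "T c \<le> T (i, i)")
    case True
    have "k < i" if "k \<in> {1..n}" "T (k, k) < T c" for k
      using diag[OF \<open>i \<in> {1..n}\<close> that(1)] that(2) True by linarith
    then have "{k \<in> {1..n}. T (k, k) < T c} \<subseteq> {1..<i}" by auto
    from card_mono[OF _ this] have "f c \<le> i - 1" by (simp add: f_def)
    with True that show ?thesis by auto
  next
    case False
    have "T (k, k) < T c" if "k \<in> {1..i}" for k
      using diag[of k i] that \<open>i \<in> {1..n}\<close> False by simp
    then have "{1..i} \<subseteq> {k \<in> {1..n}. T (k, k) < T c}" using that by auto
    from card_mono[OF _ this] have "i \<le> f c" by (simp add: f_def)
    with False show ?thesis by simp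
  qed
  have slot: "slot_assignment n f"
    unfolding slot_assignment_def
  proof clarify
    fix i j assume "(i, j) \<in> ?C"
    then have ij: "1 \<le> i" "i < j" "j \<le> n" by (auto simp: off_diagonal_def)
    show "f (i, j) \<in> {i..<j}"
      using right[of i j] down[of i j] f[of i "(i, j)"] f[of j "(i, j)"] ij by simp
  qed
  define a where "a k = card {c \<in> ?C. f c = k}" for k
  have "T (i, i) = (\<Sum>k=1..<i. a k) + i" if i: "i \<in> {1..n}" for i
  proof -
    have "(i, i) \<in> ?S" using i by (simp add: shifted_staircase_def)
    then have Ti: "T (i, i) \<in> {1..Suc n choose 2}" using bij bij_betwE by blast
    have "T ` {c \<in> ?S. T c \<le> T (i, i)} = {1..T (i, i)}"
    proof (intro equalityI subsetI)
      fix x assume "x \<in> {1..T (i, i)}"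
      moreover from this Ti have "x \<in> T ` ?S" using bij by (auto simp: bij_betw_def)
      ultimately show "x \<in> T ` {c \<in> ?S. T c \<le> T (i, i)}" by auto
    qed (use bij in \<open>auto simp: bij_betw_def\<close>)
    moreover have "inj_on T {c \<in> ?S. T c \<le> T (i, i)}"
      using bij by (auto simp: bij_betw_def intro: inj_on_subset)
    ultimately have "T (i, i) = card {c \<in> ?S. T c \<le> T (i, i)}"
      by (metis card_atLeastAtMost card_image diff_Suc_1)
    also have "{c \<in> ?S. T c \<le> T (i, i)} = (\<lambda>k. (k, k)) ` {1..i} \<union> {c \<in> ?C. f c < i}"
    proof -
      have "c \<in> (\<lambda>k. (k, k)) ` {1..i} \<union> {c \<in> ?C. f c < i}" if "c \<in> ?S" "T c \<le> T (i, i)" for c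
        using that(1)
        by (cases rule: shifted_staircase_cases) (use that(2) i diag f in auto)
      moreover have "T c \<le> T (i, i)" if "c \<in> (\<lambda>k. (k, k)) ` {1..i} \<union> {c \<in> ?C. f c < i}" for c
        using that i diag f by auto
      moreover have "(\<lambda>k. (k, k)) ` {1..i} \<union> {c \<in> ?C. f c < i} \<subseteq> ?S"
        using i off_diagonal_subset by (auto simp: shifted_staircase_def)
      ultimately show ?thesis by blast
    qed
    also have "card \<dots> = (\<Sum>k=1..<i. a k) + i"
      using card_diagonal_and_lower_slots[OF slot] i by (simp add: a_def)
    finally show ?thesis .
  qed
  then have "diag_vector n T = diag_positions n a"
    by (simp add: diag_vector_eq_diag_positions_iff)
  moreover have "realizable n a" using slot by (auto simp: realizable_def a_def)
  ultimately show ?thesis by blast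
qed

section \<open>From slot assignments to tableaux\<close>

text \<open>An extremal choice replaces repeated exchanges: the weight \<open>fst c + snd c\<close>
  grows along rows and columns, so moving a larger value to the farther cell raises the weighted
  sum.\<close>

lemma realizable_monotone:
  assumes "realizable n a"
  obtains f where "slot_assignment n f" "\<forall>k\<in>{1..<n}. card {c \<in> off_diagonal n. f c = k} = a k"
    "\<And>i j i' j'. (i, j) \<in> off_diagonal n \<Longrightarrow> (i', j') \<in> off_diagonal n \<Longrightarrow> i \<le> i' \<Longrightarrow> j \<le> j'
      \<Longrightarrow> f (i, j) \<le> f (i', j')"
proof -
  let ?C = "off_diagonal n"
  let ?P = "\<lambda>f. slot_assignment n f \<and> (\<forall>k\<in>{1..<n}. card {c \<in> ?C. f c = k} = a k)"
  let ?w = "\<lambda>f :: nat \<times> nat \<Rightarrow> nat. \<Sum>c\<in>?C. f c * (fst c + snd c)"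
  have bound: "?w f < (\<Sum>c\<in>?C. n * (fst c + snd c)) + 1" if "?P f" for f
  proof -
    have "?w f \<le> (\<Sum>c\<in>?C. n * (fst c + snd c))"
      using slot_assignment_range[of n f] that by (intro sum_mono mult_right_mono) fastforce+
    then show ?thesis by simp
  qed
  \<comment> \<open>A monotonicity violation in an \<open>f\<close> maximizing \<open>?w\<close> could be swapped away, increasing \<open>?w\<close>.\<close>
  from assms obtain f0 where "?P f0" by (auto simp: realizable_def)
  from ex_has_greatest_nat[where P = ?P and f = ?w, OF this] bound
  obtain f where f: "?P f" and max: "\<And>g. ?P g \<Longrightarrow> ?w g \<le> ?w f" by blast
  have "f (i, j) \<le> f (i', j')"
    if ij: "(i, j) \<in> ?C" and ij': "(i', j') \<in> ?C" and le: "i \<le> i'" "j \<le> j'" for i j i' j'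
  proof (rule ccontr)
    assume "\<not> f (i, j) \<le> f (i', j')"
    then have less: "f (i', j') < f (i, j)" by simp
    let ?c = "(i, j)" and ?c' = "(i', j')"
    let ?t = "Transposition.transpose ?c ?c'"
    define g where "g = f \<circ> ?t"
    have t: "?t x \<in> ?C \<longleftrightarrow> x \<in> ?C" for x
      using ij ij' by (auto simp: Transposition.transpose_def)
    have range: "i \<le> f ?c" "f ?c < j" "i' \<le> f ?c'" "f ?c' < j'"
      using f ij ij' by (auto simp: slot_assignment_def)
    \<comment> \<open>Both values fit both intervals, because
      \<open>i \<le> i' \<le> f ?c' < f ?c < j \<le> j'\<close>.\<close>
    have "slot_assignment n g"
      unfolding slot_assignment_def g_def
      using f range less le by (auto simp: slot_assignment_def Transposition.transpose_def)
    moreover have "card {c \<in> ?C. g c = k} = card {c \<in> ?C. f c = k}" for k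
    proof (rule bij_betw_same_card[of ?t])
      show "bij_betw ?t {c \<in> ?C. g c = k} {c \<in> ?C. f c = k}"
        by (rule bij_betw_byWitness[of _ ?t]) (auto simp: t g_def)
    qed
    ultimately have "?w g \<le> ?w f" using f by (intro max) auto
    moreover have "?w f < ?w g"
    proof -
      have ne: "?c \<noteq> ?c'" using less by auto
      have split: "?w h = h ?c * (i + j) + h ?c' * (i' + j') + (\<Sum>c\<in>?C - {?c, ?c'}. h c * (fst c + snd c))"
        for h :: "nat \<times> nat \<Rightarrow> nat"
      proof -
        have "?w h = (\<Sum>c\<in>{?c, ?c'}. h c * (fst c + snd c)) + (\<Sum>c\<in>?C - {?c, ?c'}. h c * (fst c + snd c))"
          using ij ij' by (subst sum.subset_diff[of "{?c, ?c'}"]) (auto simp: add.commute)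
        then show ?thesis using ne by simp
      qed
      have rest: "(\<Sum>c\<in>?C - {?c, ?c'}. g c * (fst c + snd c)) = (\<Sum>c\<in>?C - {?c, ?c'}. f c * (fst c + snd c))"
        by (intro sum.cong) (auto simp: g_def)
      have "i + j < i' + j'" using le ne by auto
      then obtain d where d: "i' + j' = i + j + d" "d > 0" using less_imp_add_positive by metis
      obtain e where e: "f ?c = f ?c' + e" "e > 0" using less less_imp_add_positive by metis
      \<comment> \<open>Rearrangement inequality: the two sides differ by
        \<open>e * d\<close>.\<close>
      have "f ?c * (i + j) + f ?c' * (i' + j') < f ?c' * (i + j) + f ?c * (i' + j')"
        unfolding d(1) e(1) using d(2) e(2) by (simp add: algebra_simps)
      moreover have "g ?c = f ?c'" "g ?c' = f ?c" by (auto simp: g_def)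
      ultimately show ?thesis unfolding split rest by simp
    qed
    ultimately show False by simp
  qed
  with f that show thesis by blast
qed

text \<open>Distinct keys have distinct ranks, and an injection of \<open>S\<close> into a set of
  the same finite size is onto. This turns the keys of cells into tableau entries.\<close>

lemma rank_bij_betw:
  fixes key :: "'c \<Rightarrow> 'k :: linorder"
  assumes "finite S" "inj_on key S"
  defines "pos \<equiv> \<lambda>c. card {c' \<in> S. key c' \<le> key c}"
  shows "bij_betw pos S {1..card S}"
    and "\<And>c c'. c' \<in> S \<Longrightarrow> key c < key c' \<Longrightarrow> pos c < pos c'"
proof -
  show less: "pos c < pos c'" if "c' \<in> S" "key c < key c'" for c c'
  proof -
    have "{x \<in> S. key x \<le> key c} \<subseteq> {x \<in> S. key x \<le> key c'}" using that by auto
    moreover have "c' \<in> {x \<in> S. key x \<le> key c'} - {x \<in> S. key x \<le> key c}" using that by auto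
    ultimately have "{x \<in> S. key x \<le> key c} \<subset> {x \<in> S. key x \<le> key c'}" by blast
    then show ?thesis unfolding pos_def using assms(1) by (intro psubset_card_mono) auto
  qed
  have inj: "inj_on pos S"
  proof (rule inj_onI)
    fix c c' assume *: "c \<in> S" "c' \<in> S" "pos c = pos c'"
    then have "key c = key c'" using less by (metis less_irrefl linorder_neq_iff)
    with * assms(2) show "c = c'" by (blast dest: inj_onD)
  qed
  have "pos ` S \<subseteq> {1..card S}"
  proof clarify
    fix c assume "c \<in> S"
    then have "{c} \<subseteq> {c' \<in> S. key c' \<le> key c}" by auto
    from card_mono[OF _ this] assms(1) have "1 \<le> pos c" by (simp add: pos_def)
    moreover have "pos c \<le> card S" unfolding pos_def using assms(1) by (intro card_mono) auto
    ultimately show "pos c \<in> {1..card S}" by simp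
  qed
  moreover have "card (pos ` S) = card {1..card S}" using inj by (simp add: card_image)
  ultimately have "pos ` S = {1..card S}" by (intro card_subset_eq) auto
  with inj show "bij_betw pos S {1..card S}" by (simp add: bij_betw_def)
qed

text \<open>A key increasing along rows and columns ranks the cells into a tableau. On the shape,
  level \<open>2 * k\<close> holds only \<open>(k, k)\<close> and level \<open>2 * k + 1\<close>
  holds the cells of slot \<open>k\<close>, so the number of cells up to \<open>(i, i)\<close> is
  the prescribed diagonal entry.\<close>

lemma realizable_imp_shifted_tableau:
  assumes "realizable n a"
  shows "\<exists>T\<in>shifted_tableaux n. diag_vector n T = diag_positions n a"
proof -
  let ?S = "shifted_staircase n" and ?C = "off_diagonal n"
  obtain f where slot: "slot_assignment n f"
    and card: "\<forall>k\<in>{1..<n}. card {c \<in> ?C. f c = k} = a k"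
    and mono: "\<And>i j i' j'. (i, j) \<in> ?C \<Longrightarrow> (i', j') \<in> ?C \<Longrightarrow> i \<le> i' \<Longrightarrow> j \<le> j'
      \<Longrightarrow> f (i, j) \<le> f (i', j')"
    by (rule realizable_monotone[OF assms]) (rule that)
  \<comment> \<open>The cells are filled in by level, and lexicographically within a level.\<close>
  define level where "level = (\<lambda>(i, j). if i = j then 2 * i else 2 * f (i, j) + 1)"
  \<comment> \<open>\<open>M\<close> exceeds every value of \<open>lex\<close> on the shape, and
    \<open>Suc n\<close> exceeds every column index. Hence \<open>key\<close> encodes the pair of
    \<open>level\<close> and \<open>lex\<close> in lexicographic order.\<close>
  define M where "M = Suc n * Suc n"
  define lex where "lex = (\<lambda>(i, j). i * Suc n + j)"
  define key where "key c = level c * M + lex c" for c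
  have lex_less: "lex c < M" if "c \<in> ?S" for c
  proof -
    obtain i j where c: "c = (i, j)" by fastforce
    have "i * Suc n + j < i * Suc n + Suc n" "Suc i * Suc n \<le> Suc n * Suc n"
      using that by (auto simp: c shifted_staircase_def simp del: mult_Suc_right intro!: mult_right_mono)
    then show ?thesis by (simp add: c lex_def M_def)
  qed
  have lex_inj: "inj_on lex ?S"
    by (rule inj_on_inverseI[of _ "\<lambda>x. (x div Suc n, x mod Suc n)"])
      (auto simp: shifted_staircase_def lex_def simp del: mult_Suc_right)
  have key_inj: "inj_on key ?S"
  proof (rule inj_onI)
    fix c c' assume *: "c \<in> ?S" "c' \<in> ?S" "key c = key c'"
    from *(1,2) have "key c mod M = lex c" "key c' mod M = lex c'"
      using lex_less[of c] lex_less[of c'] by (simp_all add: key_def)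
    with *(3) have "lex c = lex c'" by metis
    then show "c = c'" using lex_inj *(1,2) by (blast dest: inj_onD)
  qed
  have level_key: "key c < key c'" if "level c < level c'" "c \<in> ?S" for c c'
  proof -
    have "key c < Suc (level c) * M" using lex_less[OF that(2)] by (simp add: key_def)
    also have "\<dots> \<le> level c' * M" using that(1) by (intro mult_right_mono) auto
    finally show ?thesis by (simp add: key_def)
  qed
  have key_step: "key c < key c'" if "level c \<le> level c'" "lex c < lex c'" for c c'
    using that by (auto simp: key_def intro!: add_le_less_mono mult_right_mono)
  have range: "i \<le> f (i, j)" "f (i, j) < j" if "(i, j) \<in> ?C" for i j
    using slot that by (auto simp: slot_assignment_def)
  define T where "T = restrict (\<lambda>c. card {c' \<in> ?S. key c' \<le> key c}) ?S"
  note rank = rank_bij_betw[OF finite_shifted_staircase key_inj]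
  have "bij_betw T ?S {1..Suc n choose 2}"
    using rank(1) unfolding card_shifted_staircase T_def by (simp cong: bij_betw_cong)
  moreover have T_less: "T c < T c'" if "c \<in> ?S" "c' \<in> ?S" "key c < key c'" for c c'
    using rank(2)[OF that(2,3)] that(1,2) by (simp add: T_def)
  have "T (i, j) < T (Suc i, j)" if "(i, j) \<in> ?S" "(Suc i, j) \<in> ?S" for i j
  proof (intro T_less key_step that)
    have C: "(i, j) \<in> ?C" using that by (auto simp: shifted_staircase_def off_diagonal_def)
    show "level (i, j) \<le> level (Suc i, j)"
    \<comment> \<open>A step down onto the diagonal uses \<open>f (i, j) < j\<close>; any other step
      down uses monotonicity of \<open>f\<close>.\<close>
    proof (cases "Suc i = j")
      case True
      then show ?thesis using range[OF C] by (auto simp: level_def)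
    next
      case False
      then have "(Suc i, j) \<in> ?C" using that by (auto simp: shifted_staircase_def off_diagonal_def)
      from mono[OF C this] C False show ?thesis by (auto simp: level_def off_diagonal_def)
    qed
  qed (simp add: lex_def)
  moreover have "T (i, j) < T (i, Suc j)" if "(i, j) \<in> ?S" "(i, Suc j) \<in> ?S" for i j
  proof (intro T_less key_step that)
    have C: "(i, Suc j) \<in> ?C" using that by (auto simp: shifted_staircase_def off_diagonal_def)
    show "level (i, j) \<le> level (i, Suc j)"
    proof (cases "i = j")
      case True
      then show ?thesis using range[OF C] by (auto simp: level_def)
    next
      case False
      then have "(i, j) \<in> ?C" using that by (auto simp: shifted_staircase_def off_diagonal_def)
      from mono[OF this C] C False show ?thesis by (auto simp: level_def off_diagonal_def)
    qed
  qed (simp add: lex_def)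
  ultimately have T: "T \<in> shifted_tableaux n"
    by (auto simp: shifted_tableaux_def T_def)
  have "T (i, i) = (\<Sum>k=1..<i. a k) + i" if i: "i \<in> {1..n}" for i
  proof -
    have iS: "(i, i) \<in> ?S" using i by (simp add: shifted_staircase_def)
    have diag: "key (k, k) \<le> key (i, i) \<longleftrightarrow> k \<le> i" if "k \<in> {1..n}" for k
      using level_key[of "(k, k)" "(i, i)"] level_key[of "(i, i)" "(k, k)"] that iS
      by (cases k i rule: linorder_cases) (auto simp: level_def shifted_staircase_def)
    \<comment> \<open>The odd level of \<open>c\<close> never equals the even level of
      \<open>(i, i)\<close>, so \<open>level\<close> alone decides which comes first.\<close>
    have off: "key c \<le> key (i, i) \<longleftrightarrow> f c < i" if "c \<in> ?C" for c
    proof -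
      have "level c = 2 * f c + 1" "c \<in> ?S"
        using that off_diagonal_subset by (auto simp: level_def off_diagonal_def)
      moreover have "level (i, i) = 2 * i" by (simp add: level_def)
      ultimately show ?thesis
        using level_key[of c "(i, i)"] level_key[of "(i, i)" c] iS by (cases "f c < i") auto
    qed
    have "{c \<in> ?S. key c \<le> key (i, i)} = (\<lambda>k. (k, k)) ` {1..i} \<union> {c \<in> ?C. f c < i}"
    proof -
      have "c \<in> (\<lambda>k. (k, k)) ` {1..i} \<union> {c \<in> ?C. f c < i}" if "c \<in> ?S" "key c \<le> key (i, i)" for c
        using that(1)
        by (cases rule: shifted_staircase_cases) (use that(2) i diag off[of c] in auto)
      moreover have "key c \<le> key (i, i)" if "c \<in> (\<lambda>k. (k, k)) ` {1..i} \<union> {c \<in> ?C. f c < i}" for c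
        using that i diag off[of c] by auto
      moreover have "(\<lambda>k. (k, k)) ` {1..i} \<union> {c \<in> ?C. f c < i} \<subseteq> ?S"
        using i off_diagonal_subset by (auto simp: shifted_staircase_def)
      ultimately show ?thesis by blast
    qed
    then have "T (i, i) = (\<Sum>k=1..<i. card {c \<in> ?C. f c = k}) + i"
      using card_diagonal_and_lower_slots[OF slot] i iS by (simp add: T_def)
    also have "(\<Sum>k=1..<i. card {c \<in> ?C. f c = k}) = (\<Sum>k=1..<i. a k)"
      using card i by (intro sum.cong) auto
    finally show ?thesis .
  qed
  then have "diag_vector n T = diag_positions n a"
    by (simp add: diag_vector_eq_diag_positions_iff)
  with T show ?thesis by blast
qed

section \<open>Comparison of the two counts\<close>

text \<open>An infinite set has \<open>card\<close> 0, so finiteness lets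
  \<open>num_tableaux n a \<noteq> 0\<close> be read as existence of a tableau.\<close>

lemma finite_shifted_tableaux: "finite (shifted_tableaux n)"
proof (rule finite_subset)
  show "shifted_tableaux n \<subseteq> shifted_staircase n \<rightarrow>\<^sub>E {1..Suc n choose 2}"
    by (auto simp: shifted_tableaux_def PiE_def dest: bij_betw_apply)
qed (simp add: finite_PiE)

text \<open>Equal kernels make sending \<open>f x\<close> to \<open>g x\<close> a well-defined
  bijection of the images. It is applied to functions \<open>a\<close> whose values outside
  \<open>{1..<n}\<close> are arbitrary and ignored by both maps.\<close>

lemma card_image_eq_if_same_kernel:
  assumes "\<And>x y. x \<in> A \<Longrightarrow> y \<in> A \<Longrightarrow> f x = f y \<longleftrightarrow> g x = g y"
  shows "card (f ` A) = card (g ` A)"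
proof -
  let ?h = "\<lambda>y. g (inv_into A f y)"
  have h: "?h (f x) = g x" if "x \<in> A" for x
    using assms[of "inv_into A f (f x)" x] that by (simp add: inv_into_into f_inv_into_f)
  then have "inj_on ?h (f ` A)" using assms by (auto simp: inj_on_def)
  moreover have "?h ` f ` A = g ` A" using h by (simp add: image_image)
  ultimately show ?thesis by (metis card_image)
qed

theorem corollary15p2:
  fixes n :: nat
  assumes "n \<ge> 1"
  shows "card (diag_vector n ` shifted_tableaux n) = card (lattice_points (associahedron (n - 1)))
    \<and> (\<forall>a :: nat \<Rightarrow> nat.
          num_tableaux n a \<noteq> 0 \<longleftrightarrow> point_of (n - 1) a \<in> lattice_points (associahedron (n - 1)))"
proof (intro conjI allI)
  have same_kernel: "point_of (n - 1) a = point_of (n - 1) b \<longleftrightarrow> diag_positions n a = diag_positions n b"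
    for a b
    using assms by (auto simp: point_of_eq_iff diag_positions_eq_iff)
  have realizable_cong: "realizable n a \<longleftrightarrow> realizable n b"
    if "diag_positions n a = diag_positions n b" for a b
    using that unfolding realizable_def diag_positions_eq_iff by auto
  have diags: "diag_vector n ` shifted_tableaux n = diag_positions n ` Collect (realizable n)"
  proof (intro equalityI subsetI)
    fix d assume "d \<in> diag_vector n ` shifted_tableaux n"
    then show "d \<in> diag_positions n ` Collect (realizable n)"
      using shifted_tableaux_imp_realizable by fast
  next
    fix d assume "d \<in> diag_positions n ` Collect (realizable n)"
    then obtain a where "realizable n a" "d = diag_positions n a" by blast
    with realizable_imp_shifted_tableau[of n a] show "d \<in> diag_vector n ` shifted_tableaux n"
      by (metis imageI)
  qed
  have points: "lattice_points (associahedron (n - 1)) = point_of (n - 1) ` Collect (realizable n)"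
    using realizable_imp_lattice_point[OF assms] lattice_point_imp_realizable[OF assms] by blast
  show "card (diag_vector n ` shifted_tableaux n) = card (lattice_points (associahedron (n - 1)))"
    unfolding diags points by (rule card_image_eq_if_same_kernel) (rule same_kernel[symmetric])
  fix a :: "nat \<Rightarrow> nat"
  have "num_tableaux n a \<noteq> 0 \<longleftrightarrow> diag_positions n a \<in> diag_vector n ` shifted_tableaux n"
    unfolding num_tableaux_def diag_positions_def[symmetric]
    using finite_shifted_tableaux[of n]
    by (auto simp: card_eq_0_iff image_iff eq_commute[of "diag_positions n a"])
  \<comment> \<open>Membership in the image yields only some realizable function with the same
    diagonal positions; \<open>realizable_cong\<close> transfers this to \<open>a\<close>.\<close>
  also have "\<dots> \<longleftrightarrow> realizable n a" unfolding diags using realizable_cong by blast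
  also have "\<dots> \<longleftrightarrow> point_of (n - 1) a \<in> lattice_points (associahedron (n - 1))"
    unfolding points using realizable_cong same_kernel by blast
  finally show "num_tableaux n a \<noteq> 0 \<longleftrightarrow> point_of (n - 1) a \<in> lattice_points (associahedron (n - 1))" .
qed

end
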